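(* There is no MK-curve $C\subset\mathbb{P}^2_{\mathbb{C}}$ of degree $10$ all of whose singularities are nodes (type $A_1$), tacnodes (type $A_3$) or ordinary triple points (type $D_4$).
   Context: ADE singularities of plane curves are those locally analytically equivalent to $A_k: x^2+y^{k+1}=0$ ($k\ge 1$), $D_k: x^2y+y^{k-1}=0$ ($k\geq 4$), $E_6: x^3+y^4=0$, $E_7: x^3+xy^3=0$, $E_8: x^3+y^5=0$. Let $C$ be a reduced plane curve of even degree with only ADE singularities, and let $X$ be the double cover of $\mathbb{P}^2_{\mathbb{C}}$ branched along $C$. Over each $p\in \mathrm{Sing}(C)$, $X$ has a rational double point of the same type. The Miyaoka-Kobayashi number of $p$ is $m(p)=3\left(e(E_p)-\frac{1}{\mathrm{ord}(G_p)}\right)-K(E_p)^2$, where $E_p$ is the exceptional curve over $p$ in the minimal resolution of $X$, $e$ is the topological Euler characteristic, $G_p$ is the associated small group, and $K(E_p)$ is the local canonical divisor (which is zero for rational double points). Explicitly, $m(A_k)=3(k+1)-\frac{3}{k+1}$ for $k\ge 1$, $m(D_k)=3(k+1)-\frac{3}{4(k-2)}$ for $k\ge 4$, $m(E_6)=\frac{167}{8}$, $m(E_7)=\frac{383}{16}$, $m(E_8)=\frac{1079}{40}$. Put $m(C)=\sum_{p\in \mathrm{Sing}(C)}m(p)$. MK-curve: a reduced curve $C\subset\mathbb{P}^2_{\mathbb{C}}$ of even degree $n\geq 6$ with only ADE singularities such that $m(C)=\frac{n}{2}(5n-6)$. *)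

theory Defs
  imports
    "HOL-Analysis.Analysis"
    "HOL-Library.Poly_Mapping"
    "HOL-Computational_Algebra.Squarefree"
begin

type_synonym form3 = "(3 \<Rightarrow>\<^sub>0 nat) \<Rightarrow>\<^sub>0 complex"

definition form_eval :: "form3 \<Rightarrow> complex^3 \<Rightarrow> complex" where
  "form_eval F v =
     (\<Sum>k\<in>Poly_Mapping.keys F. Poly_Mapping.lookup F k * (\<Prod>i\<in>UNIV. (v $ i) ^ Poly_Mapping.lookup k i))"

definition homogeneous_form :: "nat \<Rightarrow> form3 \<Rightarrow> bool" where
  "homogeneous_form n F \<longleftrightarrow>
     (\<forall>k\<in>Poly_Mapping.keys F. (\<Sum>i\<in>UNIV. Poly_Mapping.lookup k i) = n)"

text \<open>
  A reduced plane curve of degree \<open>n\<close> is given by a squarefree form of degree \<open>n\<close>, which it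
  determines up to a nonzero constant. Squarefreeness is meant in the polynomial ring
  \<open>\<complex>[x\<^sub>1, x\<^sub>2, x\<^sub>3]\<close> and excludes the zero form.
\<close>

definition reduced_plane_curve :: "nat \<Rightarrow> form3 \<Rightarrow> bool" where
  "reduced_plane_curve n F \<longleftrightarrow> homogeneous_form n F \<and> squarefree F"

text \<open>A point of the projective plane is the set of its homogeneous coordinate vectors.\<close>

definition proj_plane :: "(complex^3) set set" where
  "proj_plane = {{c *s v | c. c \<noteq> 0} | v. v \<noteq> 0}"

definition partial_deriv :: "form3 \<Rightarrow> 3 \<Rightarrow> complex^3 \<Rightarrow> complex" where
  "partial_deriv F i v = deriv (\<lambda>z. form_eval F (\<chi> j. if j = i then z else v $ j)) (v $ i)"

definition Sing :: "form3 \<Rightarrow> (complex^3) set set" where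
  "Sing F = {p \<in> proj_plane. \<forall>v\<in>p. form_eval F v = 0 \<and> (\<forall>i. partial_deriv F i v = 0)}"

text \<open>
  Holomorphy in two variables on an open set: Frechet differentiability with a
  complex-linear derivative.
\<close>

definition holomorphic2_on :: "(complex \<times> complex \<Rightarrow> complex) \<Rightarrow> (complex \<times> complex) set \<Rightarrow> bool" where
  "holomorphic2_on f S \<longleftrightarrow>
     (\<forall>z\<in>S. \<exists>a b. (f has_derivative (\<lambda>(h, k). a * h + b * k)) (at z))"

definition biholomorphism ::
  "(complex \<times> complex) set \<Rightarrow> (complex \<times> complex) set \<Rightarrow> (complex \<times> complex \<Rightarrow> complex \<times> complex) \<Rightarrow> bool" where
  "biholomorphism U V \<phi> \<longleftrightarrow>
     open U \<and> open V \<and> bij_betw \<phi> U V \<and>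
     holomorphic2_on (fst \<circ> \<phi>) U \<and> holomorphic2_on (snd \<circ> \<phi>) U \<and>
     holomorphic2_on (fst \<circ> inv_into U \<phi>) V \<and> holomorphic2_on (snd \<circ> inv_into U \<phi>) V"

text \<open>
  Local analytic equivalence at the origin of the curve germs \<open>f = 0\<close> and \<open>g = 0\<close>: a local change
  of coordinates carries the ideal generated by \<open>g\<close> to the ideal generated by \<open>f\<close>, so the two
  equations agree up to a nowhere vanishing factor \<open>u\<close>.
\<close>

definition locally_analytically_equivalent ::
  "(complex \<times> complex \<Rightarrow> complex) \<Rightarrow> (complex \<times> complex \<Rightarrow> complex) \<Rightarrow> bool" where
  "locally_analytically_equivalent f g \<longleftrightarrow>
     (\<exists>U V \<phi> u. biholomorphism U V \<phi> \<and> (0, 0) \<in> U \<and> \<phi> (0, 0) = (0, 0) \<and>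
        holomorphic2_on u U \<and> (\<forall>z\<in>U. u z \<noteq> 0 \<and> f z = u z * g (\<phi> z)))"

text \<open>
  Local equation of the curve at \<open>p\<close> in affine coordinates centred at \<open>p\<close>: homogeneous coordinates
  are chosen by an invertible matrix \<open>M\<close> so that \<open>p = [1 : 0 : 0]\<close>, and the first one is set to 1.
  Another choice of \<open>M\<close> gives a locally analytically equivalent equation.
\<close>

definition local_equation :: "form3 \<Rightarrow> (complex^3) set \<Rightarrow> complex \<times> complex \<Rightarrow> complex" where
  "local_equation F p =
     (let M = (SOME M :: complex^3^3. invertible M \<and> M *v vector [1, 0, 0] \<in> p)
      in (\<lambda>(x, y). form_eval F (M *v vector [1, x, y])))"

datatype ade_type = Type_A nat | Type_D nat | Type_E6 | Type_E7 | Type_E8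

text \<open>The index bounds avoid the smooth germ \<open>A\<^sub>0\<close> and the coincidence of \<open>D\<^sub>3\<close> with \<open>A\<^sub>3\<close>.\<close>

fun valid_ade :: "ade_type \<Rightarrow> bool" where
  "valid_ade (Type_A k) \<longleftrightarrow> k \<ge> 1"
| "valid_ade (Type_D k) \<longleftrightarrow> k \<ge> 4"
| "valid_ade Type_E6 \<longleftrightarrow> True"
| "valid_ade Type_E7 \<longleftrightarrow> True"
| "valid_ade Type_E8 \<longleftrightarrow> True"

fun normal_form :: "ade_type \<Rightarrow> complex \<times> complex \<Rightarrow> complex" where
  "normal_form (Type_A k) (x, y) = x ^ 2 + y ^ (k + 1)"
| "normal_form (Type_D k) (x, y) = x ^ 2 * y + y ^ (k - 1)"
| "normal_form Type_E6 (x, y) = x ^ 3 + y ^ 4"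
| "normal_form Type_E7 (x, y) = x ^ 3 + x * y ^ 3"
| "normal_form Type_E8 (x, y) = x ^ 3 + y ^ 5"

definition has_ade_type :: "form3 \<Rightarrow> (complex^3) set \<Rightarrow> ade_type \<Rightarrow> bool" where
  "has_ade_type F p T \<longleftrightarrow>
     valid_ade T \<and> locally_analytically_equivalent (local_equation F p) (normal_form T)"

text \<open>
  The exceptional curve over a rational double point is a tree of projective lines, one for each
  node of the Dynkin diagram, so its Euler characteristic is the rank plus one. The associated
  small group is the corresponding finite subgroup of \<open>SL(2, \<complex>)\<close>: cyclic, binary dihedral,
  binary tetrahedral, binary octahedral or binary icosahedral.
\<close>

fun exceptional_euler :: "ade_type \<Rightarrow> nat" where
  "exceptional_euler (Type_A k) = k + 1"
| "exceptional_euler (Type_D k) = k + 1"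
| "exceptional_euler Type_E6 = 7"
| "exceptional_euler Type_E7 = 8"
| "exceptional_euler Type_E8 = 9"

fun small_group_order :: "ade_type \<Rightarrow> nat" where
  "small_group_order (Type_A k) = k + 1"
| "small_group_order (Type_D k) = 4 * (k - 2)"
| "small_group_order Type_E6 = 24"
| "small_group_order Type_E7 = 48"
| "small_group_order Type_E8 = 120"

text \<open>The local canonical divisor of a rational double point is zero and contributes no term.\<close>

definition ade_mk_number :: "ade_type \<Rightarrow> real" where
  "ade_mk_number T = 3 * (real (exceptional_euler T) - 1 / real (small_group_order T))"

lemma ade_mk_number_explicit:
  "k \<ge> 1 \<Longrightarrow> ade_mk_number (Type_A k) = 3 * (real k + 1) - 3 / (real k + 1)"
  "k \<ge> 4 \<Longrightarrow> ade_mk_number (Type_D k) = 3 * (real k + 1) - 3 / (4 * (real k - 2))"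
  "ade_mk_number Type_E6 = 167 / 8"
  "ade_mk_number Type_E7 = 383 / 16"
  "ade_mk_number Type_E8 = 1079 / 40"
  by (simp_all add: ade_mk_number_def of_nat_diff right_diff_distrib)

definition mk_number :: "form3 \<Rightarrow> (complex^3) set \<Rightarrow> real" where
  "mk_number F p = ade_mk_number (THE T. has_ade_type F p T)"

definition total_mk_number :: "form3 \<Rightarrow> real" where
  "total_mk_number F = (\<Sum>p\<in>Sing F. mk_number F p)"

definition MK_curve :: "nat \<Rightarrow> form3 \<Rightarrow> bool" where
  "MK_curve n F \<longleftrightarrow>
     even n \<and> n \<ge> 6 \<and> reduced_plane_curve n F \<and>
     (\<forall>p\<in>Sing F. \<exists>T. has_ade_type F p T) \<and>
     total_mk_number F = real n / 2 * (5 * real n - 6)"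

end

theory Submission imports Defs "HOL-Complex_Analysis.Cauchy_Integral_Formula" begin

text \<open>
  Eight times the Miyaoka-Kobayashi number is 36, 90 and 117 for \<open>A\<^sub>1\<close>, \<open>A\<^sub>3\<close> and \<open>D\<^sub>4\<close>, always a
  multiple of 9, whereas \<open>8 \<cdot> 5 \<cdot> 44 = 1760\<close> is not.  What remains is that a singularity of type \<open>A\<^sub>1\<close>,
  \<open>A\<^sub>3\<close> or \<open>D\<^sub>4\<close> has no other type.  A local analytic equivalence is bi-Lipschitz near the origin, by
  the Cauchy inequality, and changes the size of the equation by bounded factors only.  So the types
  are separated by how small the normal form is at the origin and on small balls accumulating there.
\<close>

section \<open>Local analytic equivalence is bi-Lipschitz\<close>

lemma holomorphic2_on_continuous:
  assumes "holomorphic2_on f S"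
  shows "continuous_on S f"
proof (rule continuous_at_imp_continuous_on, rule ballI)
  fix z assume "z \<in> S"
  then show "isCont f z"
    using assms unfolding holomorphic2_on_def by (meson has_derivative_continuous)
qed

text \<open>The first-derivative case of Cauchy's inequality, with hypotheses stated pointwise on
  the closed disc, the form in which they hold for one-variable slices of a function of two
  variables.\<close>

lemma Cauchy_inequality_deriv:
  fixes f :: "complex \<Rightarrow> complex"
  assumes "\<And>x. x \<in> cball \<xi> r \<Longrightarrow> f field_differentiable at x" "0 < r"
    and "\<And>x. x \<in> cball \<xi> r \<Longrightarrow> norm (f x) \<le> B"
  shows "norm (deriv f \<xi>) \<le> B / r"
proof -
  have "f holomorphic_on cball \<xi> r"
    using assms(1) by (auto simp: holomorphic_on_def intro: field_differentiable_at_within)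
  then have "f holomorphic_on ball \<xi> r" "continuous_on (cball \<xi> r) f"
    using ball_subset_cball holomorphic_on_subset holomorphic_on_imp_continuous_on by blast+
  then have "norm ((deriv ^^ 1) f \<xi>) \<le> fact 1 * B / r ^ 1"
    using assms(2,3) by (intro Cauchy_inequality) (auto simp: dist_norm)
  then show ?thesis by simp
qed

text \<open>By compactness \<open>f\<close> is bounded on a closed ball about \<open>z0\<close>.
  Cauchy's inequality on discs of half the radius, one in each coordinate direction, bounds both
  partial derivatives on the half-size ball, and the mean value inequality gives the Lipschitz
  bound.\<close>

lemma holomorphic2_on_locally_Lipschitz:
  assumes f: "holomorphic2_on f S" and "open S" "z0 \<in> S"
  obtains L r where "L > 0" "r > 0" "ball z0 r \<subseteq> S"
    "\<And>z w. z \<in> ball z0 r \<Longrightarrow> w \<in> ball z0 r \<Longrightarrow> dist (f z) (f w) \<le> L * dist z w"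
proof -
  obtain e where e: "e > 0" "cball z0 e \<subseteq> S"
    using \<open>open S\<close> \<open>z0 \<in> S\<close> open_contains_cball by blast
  have "bounded (f ` cball z0 e)"
    using holomorphic2_on_continuous[OF f] e(2)
    by (intro compact_imp_bounded compact_continuous_image)
       (auto intro: continuous_on_subset)
  then obtain B where B: "B > 0" "\<And>z. z \<in> cball z0 e \<Longrightarrow> norm (f z) \<le> B"
    unfolding bounded_pos by auto
  define r where "r = e / 2"
  define L where "L = 2 * (B / r)"
  have r: "r > 0" "L > 0" using e B by (auto simp: r_def L_def)
  have sub: "ball z0 r \<subseteq> S" using e by (auto simp: r_def)
  \<comment> \<open>Halving the radius leaves room for a closed disc of radius \<open>r\<close>
    about every point of the small ball.\<close>
  have near: "z' \<in> cball z0 e" if "z \<in> ball z0 r" "dist z z' \<le> r" for z z'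
  proof -
    have "dist z0 z' \<le> dist z0 z + dist z z'" by (rule dist_triangle)
    then show ?thesis using that by (simp add: r_def)
  qed
  have "\<exists>D. (f has_derivative D) (at z) \<and> onorm D \<le> L" if z: "z \<in> ball z0 r" for z
  proof -
    obtain x y where xy: "z = (x, y)" by (cases z)
    obtain a b where ab: "(f has_derivative (\<lambda>(h, k). a * h + b * k)) (at z)"
      using f z sub unfolding holomorphic2_on_def by blast
    \<comment> \<open>Cauchy's inequality requires the slices to be holomorphic on whole discs; the
      coefficients at \<open>z\<close> itself are identified with slice derivatives in
      \<open>da\<close> and \<open>db\<close>.\<close>
    have fst_deriv: "\<exists>a. ((\<lambda>t. f (t, v)) has_field_derivative a) (at t)" if "(t, v) \<in> S" for t v
    proof -
      obtain a b where "(f has_derivative (\<lambda>(h, k). a * h + b * k)) (at (t, v))"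
        using f \<open>(t, v) \<in> S\<close> unfolding holomorphic2_on_def by blast
      then have "((\<lambda>t. f (t, v)) has_derivative (\<lambda>h. case (h, 0) of (h, k) \<Rightarrow> a * h + b * k)) (at t)"
        by (intro has_derivative_compose[where f = "\<lambda>t. (t, v)" and g = f])
           (auto intro!: derivative_eq_intros)
      then show ?thesis by (auto simp: has_field_derivative_def)
    qed
    have snd_deriv: "\<exists>b. ((\<lambda>t. f (v, t)) has_field_derivative b) (at t)" if "(v, t) \<in> S" for t v
    proof -
      obtain a b where "(f has_derivative (\<lambda>(h, k). a * h + b * k)) (at (v, t))"
        using f \<open>(v, t) \<in> S\<close> unfolding holomorphic2_on_def by blast
      then have "((\<lambda>t. f (v, t)) has_derivative (\<lambda>k. case (0, k) of (h, k) \<Rightarrow> a * h + b * k)) (at t)"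
        by (intro has_derivative_compose[where f = "\<lambda>t. (v, t)" and g = f])
           (auto intro!: derivative_eq_intros)
      then show ?thesis by (auto simp: has_field_derivative_def)
    qed
    have "((\<lambda>t. f (t, y)) has_derivative (\<lambda>h. case (h, 0) of (h, k) \<Rightarrow> a * h + b * k)) (at x)"
      using ab unfolding xy by (intro has_derivative_compose[where f = "\<lambda>t. (t, y)" and g = f])
           (auto intro!: derivative_eq_intros)
    then have "((\<lambda>t. f (t, y)) has_field_derivative a) (at x)"
      by (simp add: has_field_derivative_def)
    then have da: "a = deriv (\<lambda>t. f (t, y)) x" by (simp add: DERIV_imp_deriv)
    have "((\<lambda>t. f (x, t)) has_derivative (\<lambda>k. case (0, k) of (h, k) \<Rightarrow> a * h + b * k)) (at y)"
      using ab unfolding xy by (intro has_derivative_compose[where f = "\<lambda>t. (x, t)" and g = f])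
           (auto intro!: derivative_eq_intros)
    then have "((\<lambda>t. f (x, t)) has_field_derivative b) (at y)"
      by (simp add: has_field_derivative_def)
    then have db: "b = deriv (\<lambda>t. f (x, t)) y" by (simp add: DERIV_imp_deriv)
    have n1: "(t, y) \<in> cball z0 e" if "t \<in> cball x r" for t
      using near[OF z, of "(t, y)"] that by (simp add: xy dist_Pair_Pair)
    have n2: "(x, t) \<in> cball z0 e" if "t \<in> cball y r" for t
      using near[OF z, of "(x, t)"] that by (simp add: xy dist_Pair_Pair)
    have a: "norm a \<le> B / r"
      unfolding da
    proof (rule Cauchy_inequality_deriv[OF _ r(1)])
      show "(\<lambda>t. f (t, y)) field_differentiable at t" if "t \<in> cball x r" for t
        using fst_deriv n1[OF that] e(2) by (auto simp: field_differentiable_def)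
    qed (auto intro!: B(2) n1)
    have b: "norm b \<le> B / r"
      unfolding db
    proof (rule Cauchy_inequality_deriv[OF _ r(1)])
      show "(\<lambda>t. f (x, t)) field_differentiable at t" if "t \<in> cball y r" for t
        using snd_deriv n2[OF that] e(2) by (auto simp: field_differentiable_def)
    qed (auto intro!: B(2) n2)
    \<comment> \<open>Both \<open>norm h\<close> and \<open>norm k\<close> are at most the norm of
      the pair, whence the factor 2 in \<open>L\<close>.\<close>
    have "onorm (\<lambda>(h, k). a * h + b * k) \<le> L"
    proof (rule onorm_le, clarify)
      fix h k
      have "norm (a * h + b * k) \<le> norm a * norm h + norm b * norm k"
        by (metis norm_mult norm_triangle_ineq)
      also have "\<dots> \<le> B / r * norm (h, k) + B / r * norm (h, k)"
        using a b B r norm_fst_le[of h k] norm_snd_le[of k h] by (intro add_mono mult_mono) auto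
      finally show "norm (a * h + b * k) \<le> L * norm (h, k)" by (simp add: L_def)
    qed
    then show ?thesis using ab by blast
  qed
  then obtain D where D: "\<And>z. z \<in> ball z0 r \<Longrightarrow> (f has_derivative D z) (at z)"
    "\<And>z. z \<in> ball z0 r \<Longrightarrow> onorm (D z) \<le> L" by metis
  have "dist (f z) (f w) \<le> L * dist z w" if "z \<in> ball z0 r" "w \<in> ball z0 r" for z w
    unfolding dist_norm
    by (rule differentiable_bound[OF convex_ball has_derivative_at_withinI[OF D(1)] D(2)])
       (fact that | assumption)+
  then show ?thesis using that r sub by blast
qed

text \<open>Both maps and both estimates are included so that the relation is symmetric, and a
  single constant serves all bounds. Images of the ball may leave it, so applications first shrink
  the radius.\<close>

definition Lipschitz_comparable ::
  "('a::real_normed_vector \<Rightarrow> complex) \<Rightarrow> ('a \<Rightarrow> complex) \<Rightarrow> bool" where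
  "Lipschitz_comparable f g \<longleftrightarrow>
     (\<exists>\<phi> \<psi> L r. L \<ge> 1 \<and> r > 0 \<and> \<phi> 0 = 0 \<and> \<psi> 0 = 0 \<and>
        (\<forall>z\<in>ball 0 r. \<forall>w\<in>ball 0 r. dist (\<phi> z) (\<phi> w) \<le> L * dist z w \<and> dist (\<psi> z) (\<psi> w) \<le> L * dist z w) \<and>
        (\<forall>z\<in>ball 0 r. \<psi> (\<phi> z) = z \<and> \<phi> (\<psi> z) = z \<and>
           norm (f z) \<le> L * norm (g (\<phi> z)) \<and> norm (g z) \<le> L * norm (f (\<psi> z))))"

lemma Lipschitz_comparable_sym: "Lipschitz_comparable f g \<Longrightarrow> Lipschitz_comparable g f"
  unfolding Lipschitz_comparable_def by metis

lemma Lipschitz_prod: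
  fixes \<phi> :: "'a::metric_space \<Rightarrow> 'b::metric_space \<times> 'c::metric_space"
  assumes "dist (fst (\<phi> z)) (fst (\<phi> w)) \<le> K * d" "dist (snd (\<phi> z)) (snd (\<phi> w)) \<le> L * d"
  shows "dist (\<phi> z) (\<phi> w) \<le> (K + L) * d"
proof -
  have "dist (\<phi> z) (\<phi> w) \<le> dist (fst (\<phi> z)) (fst (\<phi> w)) + dist (snd (\<phi> z)) (snd (\<phi> w))"
    unfolding dist_prod_def by (rule sqrt_sum_squares_le_sum) auto
  then show ?thesis using assms by (simp add: distrib_right)
qed

lemma holomorphic2_map_locally_Lipschitz:
  assumes "holomorphic2_on (fst \<circ> \<phi>) S" "holomorphic2_on (snd \<circ> \<phi>) S" "open S" "z0 \<in> S"
  obtains L r where "L > 0" "r > 0" "ball z0 r \<subseteq> S"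
    "\<And>z w. z \<in> ball z0 r \<Longrightarrow> w \<in> ball z0 r \<Longrightarrow> dist (\<phi> z) (\<phi> w) \<le> L * dist z w"
proof -
  obtain K r where 1: "K > 0" "r > 0" "ball z0 r \<subseteq> S"
    "\<And>z w. z \<in> ball z0 r \<Longrightarrow> w \<in> ball z0 r \<Longrightarrow> dist ((fst \<circ> \<phi>) z) ((fst \<circ> \<phi>) w) \<le> K * dist z w"
    using holomorphic2_on_locally_Lipschitz[OF assms(1,3,4)] by metis
  obtain L q where 2: "L > 0" "q > 0"
    "\<And>z w. z \<in> ball z0 q \<Longrightarrow> w \<in> ball z0 q \<Longrightarrow> dist ((snd \<circ> \<phi>) z) ((snd \<circ> \<phi>) w) \<le> L * dist z w"
    using holomorphic2_on_locally_Lipschitz[OF assms(2,3,4)] by metis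
  show thesis
  proof
    show "K + L > 0" "min r q > 0" using 1 2 by auto
    show "ball z0 (min r q) \<subseteq> S" using 1(3) by auto
    show "dist (\<phi> z) (\<phi> w) \<le> (K + L) * dist z w"
      if "z \<in> ball z0 (min r q)" "w \<in> ball z0 (min r q)" for z w
      using 1(4)[of z w] 2(3)[of z w] that by (intro Lipschitz_prod) auto
  qed
qed

text \<open>The coordinate change and its inverse are locally Lipschitz, and by continuity the unit
  \<open>u\<close> is bounded and bounded away from zero near the origin.\<close>

lemma locally_analytically_equivalent_imp_comparable:
  assumes "locally_analytically_equivalent f g"
  shows "Lipschitz_comparable f g"
proof -
  obtain U V \<phi> u where bi: "biholomorphism U V \<phi>" and U0: "0 \<in> U" and \<phi>0: "\<phi> 0 = 0"
    and u: "holomorphic2_on u U" "\<And>z. z \<in> U \<Longrightarrow> u z \<noteq> 0 \<and> f z = u z * g (\<phi> z)"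
    using assms unfolding locally_analytically_equivalent_def by (auto simp: zero_prod_def)
  define \<psi> where "\<psi> = inv_into U \<phi>"
  have op: "open U" "open V" and bij: "bij_betw \<phi> U V"
    using bi by (auto simp: biholomorphism_def)
  have V0: "0 \<in> V" using bij U0 \<phi>0 by (metis bij_betwE)
  have inv: "\<psi> (\<phi> z) = z" if "z \<in> U" for z
    using bij that by (simp add: \<psi>_def bij_betw_inv_into_left)
  have inv': "\<phi> (\<psi> z) = z" "\<psi> z \<in> U" if "z \<in> V" for z
    using bij that by (auto simp: \<psi>_def bij_betw_inv_into_right bij_betw_def inv_into_into)
  have \<psi>0: "\<psi> 0 = 0" using inv[OF U0] \<phi>0 by simp
  obtain L1 r1 where 1: "L1 > 0" "r1 > 0" "ball 0 r1 \<subseteq> U"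
    "\<And>z w. z \<in> ball 0 r1 \<Longrightarrow> w \<in> ball 0 r1 \<Longrightarrow> dist (\<phi> z) (\<phi> w) \<le> L1 * dist z w"
    using holomorphic2_map_locally_Lipschitz[of \<phi> U 0] bi op U0 unfolding biholomorphism_def by metis
  obtain L2 r2 where 2: "L2 > 0" "r2 > 0" "ball 0 r2 \<subseteq> V"
    "\<And>z w. z \<in> ball 0 r2 \<Longrightarrow> w \<in> ball 0 r2 \<Longrightarrow> dist (\<psi> z) (\<psi> w) \<le> L2 * dist z w"
    using holomorphic2_map_locally_Lipschitz[of \<psi> V 0] bi op V0
    unfolding biholomorphism_def \<psi>_def by metis
  have "isCont u 0"
    using holomorphic2_on_continuous[OF u(1)] op U0 by (simp add: continuous_on_eq_continuous_at)
  then obtain r3 where 3: "r3 > 0" "\<And>z. dist z 0 < r3 \<Longrightarrow> dist (u z) (u 0) < norm (u 0) / 2"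
    using u(2)[OF U0] unfolding continuous_at_eps_delta by (metis half_gt_zero zero_less_norm_iff)
  define m where "m = norm (u 0)"
  have m: "m > 0" using u(2)[OF U0] by (simp add: m_def)
  have ub: "norm (u z) \<le> 2 * m" "norm (u z) \<ge> m / 2" if "norm z < r3" for z
  proof -
    have "norm (u z - u 0) < m / 2" using 3(2)[of z] that by (simp add: dist_norm m_def)
    then show "norm (u z) \<le> 2 * m" "norm (u z) \<ge> m / 2"
      using norm_triangle_ineq2[of "u z" "u 0"] norm_triangle_ineq2[of "u 0" "u z"] m
      by (auto simp: m_def norm_minus_commute)
  qed
  \<comment> \<open>Here \<open>2 * m\<close> bounds the unit and \<open>2 / m\<close> bounds its
    reciprocal.\<close>
  define L where "L = Max {1, L1, L2, 2 * m, 2 / m}"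
  have L: "L \<ge> 1" "L1 \<le> L" "L2 \<le> L" "2 * m \<le> L" "2 / m \<le> L"
    unfolding L_def by (rule Max_ge; simp)+
  \<comment> \<open>The entry \<open>r3 / L2\<close> keeps \<open>\<psi> z\<close> where
    \<open>u\<close> is controlled, since the bound on \<open>g z\<close> involves
    \<open>u (\<psi> z)\<close>.\<close>
  define r where "r = Min {r1, r2, r3, r3 / L2}"
  have r: "r \<le> r1" "r \<le> r2" "r \<le> r3" "r \<le> r3 / L2"
    unfolding r_def by (rule Min_le; simp)+
  have "r > 0" unfolding r_def using 1 2 3 by simp
  show ?thesis
    unfolding Lipschitz_comparable_def
  proof (intro exI conjI ballI)
    show "L \<ge> 1" "r > 0" "\<phi> 0 = 0" "\<psi> 0 = 0" by fact+
    fix z :: "complex \<times> complex" assume z: "z \<in> ball 0 r"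
    have zU: "z \<in> U" and zV: "z \<in> V" using z r 1(3) 2(3) by auto
    show "\<psi> (\<phi> z) = z" "\<phi> (\<psi> z) = z" using inv inv' zU zV by auto
    have "norm (f z) = norm (u z) * norm (g (\<phi> z))" using u(2)[OF zU] by (simp add: norm_mult)
    also have "\<dots> \<le> L * norm (g (\<phi> z))"
      using ub(1)[of z] z r L by (intro mult_right_mono) auto
    finally show "norm (f z) \<le> L * norm (g (\<phi> z))" .
    have "norm (\<psi> z) \<le> L2 * norm z"
      using 2(4)[of z 0] z r 2(2) \<psi>0 by (simp add: dist_norm)
    also have "\<dots> < L2 * (r3 / L2)" using z r 2(1) by (intro mult_strict_left_mono) auto
    finally have "norm (\<psi> z) < r3" using 2(1) by simp
    then have "m / 2 * norm (g z) \<le> norm (u (\<psi> z)) * norm (g z)"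
      using ub(2) by (intro mult_right_mono) auto
    also have "\<dots> = norm (f (\<psi> z))" using u(2)[OF inv'(2)[OF zV]] inv'(1)[OF zV] by (simp add: norm_mult)
    finally have "norm (g z) \<le> 2 / m * norm (f (\<psi> z))" using m by (simp add: field_simps)
    also have "\<dots> \<le> L * norm (f (\<psi> z))" using L by (intro mult_right_mono) auto
    finally show "norm (g z) \<le> L * norm (f (\<psi> z))" .
    fix w :: "complex \<times> complex" assume w: "w \<in> ball 0 r"
    have "L1 * dist z w \<le> L * dist z w" "L2 * dist z w \<le> L * dist z w"
      using L by (auto intro: mult_right_mono)
    then show "dist (\<phi> z) (\<phi> w) \<le> L * dist z w" "dist (\<psi> z) (\<psi> w) \<le> L * dist z w"
      using 1(4)[of z w] 2(4)[of z w] z w r by auto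
  qed
qed

section \<open>Two bi-Lipschitz invariants\<close>

text \<open>For holomorphic germs this means multiplicity at least three at the origin.\<close>

definition cubically_bounded :: "('a::real_normed_vector \<Rightarrow> complex) \<Rightarrow> bool" where
  "cubically_bounded f \<longleftrightarrow> (\<exists>C. \<exists>e>0. \<forall>z. norm z < e \<longrightarrow> norm (f z) \<le> C * norm z ^ 3)"

text \<open>The ball about \<open>z\<close> has radius of order \<open>norm z\<close> to the power
  \<open>M / 2\<close>; squaring the distance allows half-integral orders such as 3/2. Smallness at
  a single point would hold anywhere on the zero curve; on a ball it also controls derivatives, in
  purely metric terms.\<close>

definition flat_spots :: "nat \<Rightarrow> nat \<Rightarrow> ('a::real_normed_vector \<Rightarrow> complex) \<Rightarrow> bool" where
  "flat_spots M N f \<longleftrightarrow>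
     (\<exists>c>0. \<exists>C. \<forall>e>0. \<exists>z. z \<noteq> 0 \<and> norm z < e \<and>
        (\<forall>w. (dist w z)\<^sup>2 \<le> c * norm z ^ M \<longrightarrow> norm (f w) \<le> C * norm z ^ N))"

section \<open>Invariance of both properties under comparison\<close>

lemma cubically_bounded_cong:
  assumes "Lipschitz_comparable g f" "cubically_bounded f"
  shows "cubically_bounded g"
proof -
  obtain \<phi> L r where L: "L \<ge> 1" "r > 0" "\<phi> 0 = 0"
    and lip: "\<And>z. z \<in> ball 0 r \<Longrightarrow> dist (\<phi> z) (\<phi> 0) \<le> L * dist z 0"
    and g: "\<And>z. z \<in> ball 0 r \<Longrightarrow> norm (g z) \<le> L * norm (f (\<phi> z))"
    using assms(1) unfolding Lipschitz_comparable_def by (metis centre_in_ball)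
  obtain C e where e: "e > 0" and C: "\<And>z. norm z < e \<Longrightarrow> norm (f z) \<le> C * norm z ^ 3"
    using assms(2) unfolding cubically_bounded_def by auto
  \<comment> \<open>One factor \<open>L\<close> compares the equations, \<open>L ^ 3\<close>
    compares \<open>norm (\<phi> z)\<close> with \<open>norm z\<close>; the absolute value is taken
    because \<open>C\<close> may be negative.\<close>
  have "norm (g z) \<le> L * (\<bar>C\<bar> * L ^ 3) * norm z ^ 3" if z: "norm z < min r (e / L)" for z
  proof -
    have \<phi>z: "norm (\<phi> z) \<le> L * norm z" using lip[of z] z L by simp
    also have "\<dots> < e" using z L by (simp add: field_simps)
    finally have "norm (f (\<phi> z)) \<le> \<bar>C\<bar> * norm (\<phi> z) ^ 3"
      using C[of "\<phi> z"] by (smt (verit) mult_right_mono norm_ge_zero zero_le_power)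
    also have "\<dots> \<le> \<bar>C\<bar> * (L * norm z) ^ 3"
      using \<phi>z by (intro mult_left_mono power_mono) auto
    finally have "L * norm (f (\<phi> z)) \<le> L * (\<bar>C\<bar> * (L * norm z) ^ 3)" using L by simp
    then show ?thesis using g[of z] z by (simp add: power_mult_distrib mult_ac)
  qed
  moreover have "min r (e / L) > 0" using L e by simp
  ultimately show ?thesis unfolding cubically_bounded_def by blast
qed

text \<open>The spot at \<open>z\<close> moves to \<open>\<phi> z\<close>: a slightly smaller ball
  there is carried by \<open>\<psi>\<close> into the given ball about \<open>z\<close>. Since
  \<open>M \<ge> 2\<close>, its radius is at most \<open>norm (\<phi> z)\<close>, so it stays in the
  domain of the comparison.\<close>

lemma flat_spots_cong:
  assumes "Lipschitz_comparable f g" "flat_spots M N f" "M \<ge> 2"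
  shows "flat_spots M N g"
proof -
  obtain \<phi> \<psi> L r where L: "L \<ge> 1" "r > 0" "\<phi> 0 = 0" "\<psi> 0 = 0"
    and lip: "\<And>z w. z \<in> ball 0 r \<Longrightarrow> w \<in> ball 0 r \<Longrightarrow> dist (\<phi> z) (\<phi> w) \<le> L * dist z w"
      "\<And>z w. z \<in> ball 0 r \<Longrightarrow> w \<in> ball 0 r \<Longrightarrow> dist (\<psi> z) (\<psi> w) \<le> L * dist z w"
    and inv: "\<And>z. z \<in> ball 0 r \<Longrightarrow> \<psi> (\<phi> z) = z"
    and g: "\<And>z. z \<in> ball 0 r \<Longrightarrow> norm (g z) \<le> L * norm (f (\<psi> z))"
    using assms(1) unfolding Lipschitz_comparable_def by (elim exE conjE) (rule that; blast)
  obtain c C where c: "c > 0" and C: "\<And>e. e > 0 \<Longrightarrow> \<exists>z. z \<noteq> 0 \<and> norm z < e \<and>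
        (\<forall>w. (dist w z)\<^sup>2 \<le> c * norm z ^ M \<longrightarrow> norm (f w) \<le> C * norm z ^ N)"
    using assms(2) unfolding flat_spots_def by auto
  \<comment> \<open>\<open>L ^ 2\<close> pays for the squared Lipschitz bound of
    \<open>\<psi>\<close> and \<open>L ^ M\<close> for replacing \<open>norm (\<phi> z)\<close> by
    \<open>L * norm z\<close>; the cap at 1 keeps the radius at most
    \<open>norm (\<phi> z)\<close>.\<close>
  define c' where "c' = min c 1 / (L ^ (M + 2))"
  have "1 \<le> L ^ (M + 2)" using L by (intro one_le_power)
  then have "min c 1 \<le> L ^ (M + 2)" "0 < L ^ (M + 2)" by linarith+
  then have c': "c' > 0" "c' \<le> 1" using c unfolding c'_def by (simp_all only: divide_le_eq_1_pos) simp
  have "\<exists>z. z \<noteq> 0 \<and> norm z < e \<and>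
      (\<forall>w. (dist w z)\<^sup>2 \<le> c' * norm z ^ M \<longrightarrow> norm (g w) \<le> L * (\<bar>C\<bar> * L ^ N) * norm z ^ N)"
    if e: "e > 0" for e
  proof -
    \<comment> \<open>The entries put \<open>z\<close> in the domain and make
      \<open>norm (\<phi> z)\<close> less than \<open>e\<close>, 1 and \<open>r / 2\<close>; the
      last leaves room for a ball of radius \<open>norm (\<phi> z)\<close>.\<close>
    define d where "d = Min {r, e / L, 1 / L, r / (2 * L)}"
    have d: "d \<le> r" "d \<le> e / L" "d \<le> 1 / L" "d \<le> r / (2 * L)"
      unfolding d_def by (rule Min_le; simp)+
    have "d > 0" unfolding d_def using L e by simp
    then obtain z where z: "z \<noteq> 0" "norm z < d"
      and fz: "\<And>w. (dist w z)\<^sup>2 \<le> c * norm z ^ M \<Longrightarrow> norm (f w) \<le> C * norm z ^ N"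
      using C by blast
    have zr: "z \<in> ball 0 r" using z d by simp
    have le: "norm (\<phi> z) \<le> L * norm z" using lip(1)[of z 0] zr L by simp
    have small: "norm (\<phi> z) < e" "norm (\<phi> z) < 1" "norm (\<phi> z) < r / 2"
    proof -
      have "L * norm z < L * d" using z L by simp
      moreover have "L * d \<le> e" "L * d \<le> 1" "L * d \<le> r / 2"
        using d L by (auto simp: field_simps)
      ultimately show "norm (\<phi> z) < e" "norm (\<phi> z) < 1" "norm (\<phi> z) < r / 2"
        using le by linarith+
    qed
    have \<phi>r: "\<phi> z \<in> ball 0 r" using small L by simp
    have ge: "norm z \<le> L * norm (\<phi> z)" using lip(2)[of "\<phi> z" 0] \<phi>r L inv[OF zr] by simp
    have nz: "\<phi> z \<noteq> 0" using ge z by auto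
    have "norm (g w) \<le> L * (\<bar>C\<bar> * L ^ N) * norm (\<phi> z) ^ N"
      if w: "(dist w (\<phi> z))\<^sup>2 \<le> c' * norm (\<phi> z) ^ M" for w
    proof -
      have "c' * norm (\<phi> z) ^ M \<le> 1 * norm (\<phi> z) ^ 2"
        using c' small assms(3) by (intro mult_mono power_decreasing) auto
      then have "(dist w (\<phi> z))\<^sup>2 \<le> (norm (\<phi> z))\<^sup>2" using w by linarith
      then have "dist w (\<phi> z) \<le> norm (\<phi> z)" by (rule power2_le_imp_le) simp
      then have wr: "w \<in> ball 0 r" using small norm_triangle_sub[of w "\<phi> z"] by (simp add: dist_norm)
      have "(dist (\<psi> w) z)\<^sup>2 \<le> (L * dist w (\<phi> z))\<^sup>2"
        using lip(2)[OF wr \<phi>r] inv[OF zr] by (intro power_mono) auto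
      also have "\<dots> \<le> L\<^sup>2 * (c' * norm (\<phi> z) ^ M)" using w by (simp add: power_mult_distrib mult_left_mono)
      also have "\<dots> \<le> L\<^sup>2 * (c' * (L * norm z) ^ M)"
        using le c' by (intro mult_left_mono power_mono) auto
      also have "\<dots> = min c 1 * norm z ^ M"
        using L by (simp add: c'_def power_mult_distrib power_add power2_eq_square)
      also have "\<dots> \<le> c * norm z ^ M" by (intro mult_right_mono) auto
      finally have "norm (f (\<psi> w)) \<le> C * norm z ^ N" by (rule fz)
      also have "\<dots> \<le> \<bar>C\<bar> * (L * norm (\<phi> z)) ^ N" using ge by (intro mult_mono power_mono) auto
      finally have "L * norm (f (\<psi> w)) \<le> L * (\<bar>C\<bar> * (L * norm (\<phi> z)) ^ N)" using L by simp
      then show ?thesis using g[OF wr] by (simp add: power_mult_distrib mult_ac)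
    qed
    then show ?thesis using small nz by blast
  qed
  then show ?thesis using c' unfolding flat_spots_def by blast
qed

section \<open>The invariants of the normal forms\<close>

lemma norm_Pair_power_le:
  "norm (x, y) ^ n \<le> 2 ^ n * max (norm x ^ n) (norm y ^ n)"
proof -
  have "norm (x, y) ^ n \<le> (2 * max (norm x) (norm y)) ^ n"
    using norm_Pair_le[of x y] by (intro power_mono) auto
  also have "\<dots> = 2 ^ n * max (norm x) (norm y) ^ n" by (rule power_mult_distrib)
  also have "max (norm x) (norm y) ^ n \<le> max (norm x ^ n) (norm y ^ n)"
    by (cases "norm x \<le> norm y") (simp_all add: max_def)
  finally show ?thesis by simp
qed

section \<open>Multiplicity separates type A from types D and E\<close>

lemma not_cubically_bounded_A: "\<not> cubically_bounded (normal_form (Type_A k))"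
proof
  assume "cubically_bounded (normal_form (Type_A k))"
  then obtain C e where e: "e > 0"
    and C: "\<And>z. norm z < e \<Longrightarrow> norm (normal_form (Type_A k) z) \<le> C * norm z ^ 3"
    unfolding cubically_bounded_def by blast
  \<comment> \<open>On the axis \<open>y = 0\<close> the normal form takes the value
    \<open>t ^ 2\<close>; this \<open>t\<close> is so small that \<open>C * t < 1\<close>.\<close>
  define t where "t = min (e / 2) (1 / (\<bar>C\<bar> + 1))"
  have t: "t > 0" "t < e" "t \<le> 1 / (\<bar>C\<bar> + 1)" using e by (auto simp: t_def)
  have "norm (normal_form (Type_A k) (of_real t, 0)) \<le> C * t ^ 3"
    using C[of "(of_real t, 0)"] t by simp
  then have "t ^ 2 \<le> C * t * t ^ 2" using t by (simp add: norm_mult power3_eq_cube power2_eq_square)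
  then have "1 \<le> C * t" using t by (simp add: mult_le_cancel_right1)
  moreover have "(\<bar>C\<bar> + 1) * t \<le> 1" using t by (simp add: field_simps)
  moreover have "C * t \<le> \<bar>C\<bar> * t" using t by (intro mult_right_mono) auto
  ultimately show False using t by (simp add: distrib_right)
qed

lemma cubically_bounded_add:
  assumes "cubically_bounded f" "cubically_bounded g"
  shows "cubically_bounded (\<lambda>z. f z + g z)"
proof -
  obtain C e where 1: "e > 0" "\<And>z. norm z < e \<Longrightarrow> norm (f z) \<le> C * norm z ^ 3"
    using assms(1) unfolding cubically_bounded_def by auto
  obtain D d where 2: "d > 0" "\<And>z. norm z < d \<Longrightarrow> norm (g z) \<le> D * norm z ^ 3"
    using assms(2) unfolding cubically_bounded_def by auto
  have "norm (f z + g z) \<le> (C + D) * norm z ^ 3" if "norm z < min e d" for z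
    using 1(2)[of z] 2(2)[of z] that norm_triangle_ineq[of "f z" "g z"] by (simp add: distrib_right)
  then show ?thesis using 1(1) 2(1) unfolding cubically_bounded_def by (metis min_less_iff_conj)
qed

lemma cubically_bounded_monomial:
  assumes "i + j \<ge> 3"
  shows "cubically_bounded (\<lambda>z :: complex \<times> complex. fst z ^ i * snd z ^ j)"
proof -
  have "norm (fst z ^ i * snd z ^ j) \<le> 1 * norm z ^ 3" if "norm z < 1" for z :: "complex \<times> complex"
  proof -
    have "norm (fst z ^ i * snd z ^ j) = norm (fst z) ^ i * norm (snd z) ^ j"
      by (simp add: norm_mult norm_power)
    also have "\<dots> \<le> norm z ^ i * norm z ^ j"
      using norm_fst_le[of "fst z" "snd z"] norm_snd_le[of "snd z" "fst z"]
      by (intro mult_mono power_mono) auto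
    also have "\<dots> \<le> norm z ^ 3"
      using that assms unfolding power_add[symmetric] by (intro power_decreasing) auto
    finally show ?thesis by simp
  qed
  then show ?thesis unfolding cubically_bounded_def by (meson zero_less_one)
qed

text \<open>Every monomial of these normal forms has degree at least three; for
  \<open>Type_D k\<close> this rests on \<open>k - 1 \<ge> 3\<close>.\<close>

lemma cubically_bounded_not_A:
  assumes "valid_ade T" "\<And>k. T \<noteq> Type_A k"
  shows "cubically_bounded (normal_form T)"
proof (cases T)
  case (Type_D k)
  then have "normal_form T = (\<lambda>z. fst z ^ 2 * snd z ^ 1 + fst z ^ 0 * snd z ^ (k - 1))"
    by (auto simp: fun_eq_iff)
  then show ?thesis
    using Type_D assms by (simp only:) (intro cubically_bounded_add cubically_bounded_monomial; simp)
next
  case Type_E6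
  then have "normal_form T = (\<lambda>z. fst z ^ 3 * snd z ^ 0 + fst z ^ 0 * snd z ^ 4)"
    by (auto simp: fun_eq_iff)
  then show ?thesis
    using assms by (simp only:) (intro cubically_bounded_add cubically_bounded_monomial; simp)
next
  case Type_E7
  then have "normal_form T = (\<lambda>z. fst z ^ 3 * snd z ^ 0 + fst z ^ 1 * snd z ^ 3)"
    by (auto simp: fun_eq_iff)
  then show ?thesis
    using assms by (simp only:) (intro cubically_bounded_add cubically_bounded_monomial; simp)
next
  case Type_E8
  then have "normal_form T = (\<lambda>z. fst z ^ 3 * snd z ^ 0 + fst z ^ 0 * snd z ^ 5)"
    by (auto simp: fun_eq_iff)
  then show ?thesis
    using assms by (simp only:) (intro cubically_bounded_add cubically_bounded_monomial; simp)
qed (use assms in auto)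

text \<open>The flat spots are found on the axis \<open>x = 0\<close>.\<close>

lemma flat_spotsI:
  fixes f :: "complex \<times> complex \<Rightarrow> complex"
  assumes "M \<ge> 2"
    and f: "\<And>t x y. 0 < t \<Longrightarrow> t < 1 \<Longrightarrow> norm x ^ 2 \<le> t ^ M \<Longrightarrow> norm x \<le> t \<Longrightarrow> norm y \<le> 2 * t
      \<Longrightarrow> norm (f (x, y)) \<le> C * t ^ N"
  shows "flat_spots M N f"
proof -
  have "\<exists>z. z \<noteq> 0 \<and> norm z < e \<and>
      (\<forall>w. (dist w z)\<^sup>2 \<le> 1 * norm z ^ M \<longrightarrow> norm (f w) \<le> C * norm z ^ N)" if "e > 0" for e
  proof -
    define t where "t = min (e / 2) (1 / 2)"
    have t: "0 < t" "t < 1" "t < e" using \<open>e > 0\<close> by (auto simp: t_def)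
    define z :: "complex \<times> complex" where "z = (0, of_real t)"
    have z: "norm z = t" "z \<noteq> 0" using t by (auto simp: z_def norm_prod_def zero_prod_def)
    have bound: "norm (f (x, y)) \<le> C * t ^ N" if "(dist (x, y) (0, of_real t))\<^sup>2 \<le> t ^ M" for x y
    proof (rule f[OF t(1,2)])
      have d: "norm x \<le> dist (x, y) (0, of_real t)" "norm (y - of_real t) \<le> dist (x, y) (0, of_real t)"
        using dist_fst_le[of "(x, y)" "(0, of_real t)"] dist_snd_le[of "(x, y)" "(0, of_real t)"]
        by (auto simp: dist_norm)
      show "norm x ^ 2 \<le> t ^ M" using d(1) that by (meson norm_ge_zero order_trans power_mono)
      \<comment> \<open>The radius is thus at most \<open>t\<close>, so the second coordinate stays
        within \<open>2 * t\<close>.\<close>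
      have "t ^ M \<le> t ^ 2" using t assms(1) by (intro power_decreasing) auto
      then have "(dist (x, y) (0, of_real t))\<^sup>2 \<le> t ^ 2" using that by (rule order_trans[rotated])
      then have "dist (x, y) (0, of_real t) \<le> t"
        by (rule power2_le_imp_le) (rule less_imp_le[OF t(1)])
      moreover have "norm (complex_of_real t) = t" using t(1) by simp
      ultimately show "norm x \<le> t" "norm y \<le> 2 * t"
        using d norm_triangle_sub[of y "of_real t"] by linarith+
    qed
    have "norm (f w) \<le> C * norm z ^ N" if "(dist w z)\<^sup>2 \<le> 1 * norm z ^ M" for w
      using bound[of "fst w" "snd w", folded z_def] that unfolding z(1) mult_1 prod.collapse .
    then show ?thesis using z t(3) by blast
  qed
  then show ?thesis unfolding flat_spots_def by (meson zero_less_one)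
qed

text \<open>On the spot about \<open>(0, t)\<close> the radius makes \<open>x ^ 2\<close> at most
  \<open>t ^ N\<close>, and \<open>y ^ (k + 1)\<close> is of order \<open>t ^ (k + 1)\<close>, hence
  O(\<open>t ^ N\<close>).\<close>

lemma flat_spots_A:
  assumes "2 \<le> N" "N \<le> k + 1"
  shows "flat_spots N N (normal_form (Type_A k))"
proof (rule flat_spotsI[where C = "1 + 2 ^ (k + 1)"])
  fix t :: real and x y :: complex
  assume t: "0 < t" "t < 1" and x: "norm x ^ 2 \<le> t ^ N" and y: "norm y \<le> 2 * t"
  have "norm (x ^ 2 + y ^ (k + 1)) \<le> norm x ^ 2 + norm y ^ (k + 1)"
    by (metis norm_power norm_triangle_ineq)
  also have "\<dots> \<le> t ^ N + (2 * t) ^ (k + 1)" using x y by (intro add_mono power_mono) auto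
  also have "\<dots> \<le> t ^ N + 2 ^ (k + 1) * t ^ N"
    unfolding power_mult_distrib using t assms by (intro add_left_mono mult_left_mono power_decreasing) auto
  finally show "norm (normal_form (Type_A k) (x, y)) \<le> (1 + 2 ^ (k + 1)) * t ^ N"
    by (simp add: distrib_right)
qed fact

text \<open>The cubic part of these germs contains the line \<open>x = 0\<close> with multiplicity:
  it is \<open>x ^ 2 * y\<close> for D and \<open>x ^ 3\<close> for E. The remaining term has degree
  at least four. With \<open>x\<close> of order at most 3/2 in \<open>t\<close>, every term is
  O(\<open>t ^ 4\<close>).\<close>

lemma flat_spots_degenerate_cubic:
  assumes "valid_ade T" "\<And>k. T \<noteq> Type_A k" "T \<noteq> Type_D 4"
  shows "flat_spots 3 4 (normal_form T)"
proof (rule flat_spotsI)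
  fix t :: real and x y :: complex
  assume t: "0 < t" "t < 1" and x2: "norm x ^ 2 \<le> t ^ 3" and x: "norm x \<le> t" and y: "norm y \<le> 2 * t"
  have x3: "norm (x ^ 3) \<le> t ^ 4"
    using mult_mono[OF x2 x] t by (simp add: norm_power norm_mult power3_eq_cube power4_eq_xxxx power2_eq_square mult_ac)
  have yn: "norm (y ^ n) \<le> 2 ^ n * t ^ 4" if "n \<ge> 4" for n
  proof -
    have "norm (y ^ n) \<le> (2 * t) ^ n" unfolding norm_power by (intro power_mono y) simp
    also have "\<dots> \<le> 2 ^ n * t ^ 4"
      unfolding power_mult_distrib using t that by (intro mult_left_mono power_decreasing) auto
    finally show ?thesis .
  qed
  \<comment> \<open>The constants are the sums of the bounds for the two terms: 33 is
    \<open>1 + 2 ^ 5\<close>, and 17 is \<open>1 + 2 ^ 4\<close>, which serves both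
    \<open>Type_E6\<close> and \<open>Type_E7\<close>.\<close>
  show "norm (normal_form T (x, y)) \<le>
    (case T of Type_D k \<Rightarrow> 2 + 2 ^ (k - 1) | Type_E8 \<Rightarrow> 33 | _ \<Rightarrow> 17) * t ^ 4"
  proof (cases T)
    case (Type_D k)
    have "norm (x ^ 2 * y) \<le> t ^ 3 * (2 * t)"
      unfolding norm_mult norm_power using x2 y t by (intro mult_mono) auto
    moreover have "norm (y ^ (k - 1)) \<le> 2 ^ (k - 1) * t ^ 4" using Type_D assms by (intro yn) auto
    ultimately show ?thesis
      using norm_triangle_ineq[of "x ^ 2 * y" "y ^ (k - 1)"] Type_D
      by (simp add: distrib_right power3_eq_cube power4_eq_xxxx)
  next
    case Type_E6
    then show ?thesis using x3 yn[of 4] norm_triangle_ineq[of "x ^ 3" "y ^ 4"] by simp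
  next
    case Type_E7
    have "norm (x * y ^ 3) \<le> t * (2 * t) ^ 3"
      unfolding norm_mult norm_power using x y t by (intro mult_mono power_mono) auto
    also have "t * (2 * t) ^ 3 = 8 * t ^ 4" by (simp add: power3_eq_cube power4_eq_xxxx)
    also have "\<dots> \<le> 16 * t ^ 4" using t by simp
    finally have "norm (x * y ^ 3) \<le> 16 * t ^ 4" .
    then show ?thesis using Type_E7 x3 norm_triangle_ineq[of "x ^ 3" "x * y ^ 3"] by simp
  next
    case Type_E8
    then show ?thesis using x3 yn[of 5] norm_triangle_ineq[of "x ^ 3" "y ^ 5"] by simp
  qed (use assms in auto)
qed simp

text \<open>Differences of values at opposite points of a ball bound the gradient at its centre.\<close>

lemma not_flat_spots_A:
  assumes "k \<ge> 1"
  shows "\<not> flat_spots (k + 2) (k + 2) (normal_form (Type_A k))"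
proof
  assume "flat_spots (k + 2) (k + 2) (normal_form (Type_A k))"
  then obtain c C where c: "c > 0" and C: "\<And>e. e > 0 \<Longrightarrow> \<exists>z. z \<noteq> 0 \<and> norm z < e \<and>
      (\<forall>w. (dist w z)\<^sup>2 \<le> c * norm z ^ (k + 2) \<longrightarrow>
        norm (normal_form (Type_A k) w) \<le> C * norm z ^ (k + 2))"
    unfolding flat_spots_def by blast
  \<comment> \<open>\<open>K * s ^ (k + 2)\<close> will bound \<open>norm y ^ (k + 1)\<close>: the
    first summand comes from the value at the centre, the second from the bound on
    \<open>x ^ 2\<close>.\<close>
  define K where "K = \<bar>C\<bar> + C\<^sup>2 / (4 * c)"
  have K: "K \<ge> 0" using c by (simp add: K_def)
  define e where "e = min 1 (1 / (2 ^ (k + 1) * K + 1))"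
  have pos: "2 ^ (k + 1) * K + 1 > 0" using K by (simp add: add_nonneg_pos)
  then have "e > 0" by (simp add: e_def)
  then obtain z where z0: "z \<noteq> 0" and ze: "norm z < e"
    and fz: "\<And>w. (dist w z)\<^sup>2 \<le> c * norm z ^ (k + 2) \<Longrightarrow>
        norm (normal_form (Type_A k) w) \<le> C * norm z ^ (k + 2)"
    using C by blast
  obtain x y where z: "z = (x, y)" by (cases z)
  define s where "s = norm z"
  have s: "0 < s" "s < 1" "s < 1 / (2 ^ (k + 1) * K + 1)" using z0 ze by (auto simp: s_def e_def)
  define h where "h = sqrt (c * s ^ (k + 2))"
  have h: "h > 0" "h\<^sup>2 = c * s ^ (k + 2)" using c s by (auto simp: h_def)
  have bound: "norm ((x + a)\<^sup>2 + y ^ (k + 1)) \<le> C * s ^ (k + 2)" if "(norm a)\<^sup>2 = h\<^sup>2" for a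
  proof -
    have "dist (x + a, y) z = norm a" by (simp add: z dist_norm norm_prod_def)
    then have "(dist (x + a, y) z)\<^sup>2 \<le> c * norm z ^ (k + 2)"
      using that unfolding h(2) s_def by (simp only: order_refl)
    then show ?thesis using fz[of "(x + a, y)"] by (simp add: s_def)
  qed
  have p: "norm ((x + of_real h)\<^sup>2 + y ^ (k + 1)) \<le> C * s ^ (k + 2)" by (rule bound) simp
  have n: "norm ((x - of_real h)\<^sup>2 + y ^ (k + 1)) \<le> C * s ^ (k + 2)"
    using bound[of "- of_real h"] by simp
  have m: "norm (x\<^sup>2 + y ^ (k + 1)) \<le> C * s ^ (k + 2)"
    using fz[of z] c by (simp add: z s_def)
  \<comment> \<open>The values at two horizontally opposite points differ by
    \<open>4 * x * h\<close>. This forces \<open>x\<close> to be O(\<open>h\<close>), so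
    \<open>x ^ 2\<close> is O(\<open>s ^ (k + 2)\<close>).\<close>
  have "4 * norm x * h = norm (((x + of_real h)\<^sup>2 + y ^ (k + 1)) - ((x - of_real h)\<^sup>2 + y ^ (k + 1)))"
    using h by (simp add: power2_eq_square algebra_simps norm_mult flip: mult_2)
  also have "\<dots> \<le> C * s ^ (k + 2) + C * s ^ (k + 2)"
    using p n norm_triangle_ineq4 add_mono order_trans by blast
  also have "\<dots> = 2 * C / c * h\<^sup>2" unfolding h(2) using c by simp
  finally have "norm x \<le> C / (2 * c) * h" using h(1) c by (simp add: power2_eq_square field_simps)
  then have "norm x ^ 2 \<le> (C / (2 * c) * h) ^ 2" by (intro power_mono) auto
  also have "\<dots> = C\<^sup>2 / (4 * c) * s ^ (k + 2)"
    unfolding power_mult_distrib h(2) using c by (simp add: power2_eq_square)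
  finally have x2: "norm x ^ 2 \<le> C\<^sup>2 / (4 * c) * s ^ (k + 2)" .
  have "norm (y ^ (k + 1)) \<le> norm (x\<^sup>2 + y ^ (k + 1)) + norm (x\<^sup>2)"
    using norm_triangle_ineq4[of "x\<^sup>2 + y ^ (k + 1)" "x\<^sup>2"] by simp
  also have "\<dots> \<le> \<bar>C\<bar> * s ^ (k + 2) + C\<^sup>2 / (4 * c) * s ^ (k + 2)"
    unfolding norm_power using m x2 s mult_right_mono[OF abs_ge_self[of C], of "s ^ (k + 2)"]
    by (intro add_mono) (auto intro: order_trans)
  also have "\<dots> = K * s ^ (k + 2)" by (simp only: K_def distrib_right)
  finally have yk: "norm y ^ (k + 1) \<le> K * s ^ (k + 2)" by (simp only: norm_power)
  have "norm x \<le> s" using norm_fst_le[of x y] by (simp add: s_def z)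
  have "norm x ^ (k + 1) = norm x ^ 2 * norm x ^ (k - 1)"
    using assms by (simp flip: power_add)
  also have "\<dots> \<le> (K * s ^ (k + 2)) * 1"
  proof (intro mult_mono)
    show "norm x ^ 2 \<le> K * s ^ (k + 2)"
      using x2 s by (simp add: K_def distrib_right add_increasing)
    show "norm x ^ (k - 1) \<le> 1" using \<open>norm x \<le> s\<close> s by (intro power_le_one) auto
  qed (use K s in auto)
  finally have xk: "norm x ^ (k + 1) \<le> K * s ^ (k + 2)" by simp
  \<comment> \<open>The powers of order \<open>k + 1\<close> of both coordinates are
    O(\<open>s ^ (k + 2)\<close>), although \<open>s\<close> is the norm of the pair; the choice of
    \<open>e\<close> rules this out.\<close>
  have "s ^ (k + 1) \<le> 2 ^ (k + 1) * max (norm x ^ (k + 1)) (norm y ^ (k + 1))"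
    unfolding s_def z by (rule norm_Pair_power_le)
  also have "\<dots> \<le> 2 ^ (k + 1) * (K * s ^ (k + 2))"
    using xk yk by (intro mult_left_mono) auto
  also have "\<dots> = (2 ^ (k + 1) * K * s) * s ^ (k + 1)" by simp
  finally have "1 \<le> 2 ^ (k + 1) * K * s" using s by (simp add: mult_le_cancel_right1)
  moreover have "(2 ^ (k + 1) * K + 1) * s < 1" using s(3) pos by (simp add: field_simps)
  ultimately show False using s by (simp add: distrib_right)
qed

text \<open>The cubic \<open>x ^ 2 * y + y ^ 3\<close> has three distinct linear factors, so its
  partial derivatives \<open>2 * x * y\<close> and \<open>x ^ 2 + 3 * y ^ 2\<close> have only the
  origin as common zero, and the gradient is at least a constant times \<open>s ^ 2\<close>. A flat
  spot would make both partials O(\<open>s * h\<close>) with \<open>h\<close> of order 3/2 in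
  \<open>s\<close>.\<close>

lemma not_flat_spots_D4: "\<not> flat_spots 3 4 (normal_form (Type_D 4))"
proof
  assume "flat_spots 3 4 (normal_form (Type_D 4))"
  then obtain c C where c: "c > 0" and C: "\<And>e. e > 0 \<Longrightarrow> \<exists>z. z \<noteq> 0 \<and> norm z < e \<and>
      (\<forall>w. (dist w z)\<^sup>2 \<le> c * norm z ^ 3 \<longrightarrow> norm (normal_form (Type_D 4) w) \<le> C * norm z ^ 4)"
    unfolding flat_spots_def by blast
  \<comment> \<open>The quotient arises from writing \<open>s ^ 4\<close> as
    \<open>s * h ^ 2 / c\<close> in the differences; \<open>sqrt c\<close> absorbs a stray
    \<open>h ^ 2\<close>, which is at most \<open>sqrt c * s * h\<close>.\<close>
  define K where "K = \<bar>C\<bar> / c + sqrt c"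
  define K' where "K' = K + 3 * K\<^sup>2 * sqrt c"
  have K: "K \<ge> 0" "K' \<ge> 0" using c by (auto simp: K_def K'_def)
  \<comment> \<open>Chosen against the final inequality
    \<open>1 \<le> (16 * K')\<^sup>2 * c * s\<close>; the 16 is the \<open>2 ^ 4\<close> of
    \<open>norm_Pair_power_le\<close>.\<close>
  define e where "e = min 1 (1 / ((16 * K')\<^sup>2 * c + 1))"
  have pos: "(16 * K')\<^sup>2 * c + 1 > 0" using c by (simp add: add_nonneg_pos)
  then have "e > 0" by (simp add: e_def)
  then obtain z where z0: "z \<noteq> 0" and ze: "norm z < e"
    and fz: "\<And>w. (dist w z)\<^sup>2 \<le> c * norm z ^ 3 \<Longrightarrow> norm (normal_form (Type_D 4) w) \<le> C * norm z ^ 4"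
    using C by blast
  obtain x y where z: "z = (x, y)" by (cases z)
  define s where "s = norm z"
  have s: "0 < s" "s < 1" "s < 1 / ((16 * K')\<^sup>2 * c + 1)" using z0 ze by (auto simp: s_def e_def)
  define h where "h = sqrt (c * s ^ 3)"
  have h: "h > 0" "h\<^sup>2 = c * s ^ 3" using c s by (auto simp: h_def)
  have "h \<le> sqrt (c * s ^ 2)"
    unfolding h_def using c s by (intro real_sqrt_le_mono mult_left_mono power_decreasing) auto
  then have hs: "h \<le> sqrt c * s" using s by (simp add: real_sqrt_mult)
  then have hh: "h\<^sup>2 \<le> sqrt c * s * h" using h(1) by (simp add: power2_eq_square)
  have bound: "norm ((x + a)\<^sup>2 * (y + b) + (y + b) ^ 3) \<le> C * s ^ 4"
    if "(norm (a, b))\<^sup>2 = h\<^sup>2" for a b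
  proof -
    have "(dist (x + a, y + b) z)\<^sup>2 \<le> c * norm z ^ 3"
      using that unfolding h(2) s_def by (simp add: z dist_norm)
    then show ?thesis using fz[of "(x + a, y + b)"] by (simp add: s_def)
  qed
  have Cs: "C * s ^ 4 + C * s ^ 4 \<le> 2 * h * (\<bar>C\<bar> / c * s * h)"
  proof -
    have "2 * h * (\<bar>C\<bar> / c * s * h) = 2 * (\<bar>C\<bar> / c * s * h\<^sup>2)" by (simp add: power2_eq_square)
    also have "\<dots> = 2 * (\<bar>C\<bar> * s ^ 4)" using c unfolding h(2) by (simp add: power3_eq_cube power4_eq_xxxx)
    finally show ?thesis using s by (simp add: mult_right_mono)
  qed
  have C0: "\<bar>C\<bar> / c * s * h \<ge> 0" "sqrt c * s * h \<ge> 0" using c s h by auto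
  have Ksh: "K * s * h = \<bar>C\<bar> / c * s * h + sqrt c * s * h" by (simp add: K_def distrib_right)
  have "4 * norm (x * y) * h =
      norm (((x + of_real h)\<^sup>2 * (y + 0) + (y + 0) ^ 3) - ((x + - of_real h)\<^sup>2 * (y + 0) + (y + 0) ^ 3))"
    using h by (simp add: power2_eq_square algebra_simps norm_mult flip: mult_2)
  also have "\<dots> \<le> C * s ^ 4 + C * s ^ 4"
    by (rule order_trans[OF norm_triangle_ineq4 add_mono]; rule bound) (auto simp: norm_prod_def)
  finally have "2 * h * (2 * norm (x * y)) \<le> 2 * h * (\<bar>C\<bar> / c * s * h)" using Cs by (simp add: mult_ac)
  then have "2 * norm (x * y) \<le> \<bar>C\<bar> / c * s * h" using h by (simp only: mult_le_cancel_left_pos zero_less_numeral mult_pos_pos)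
  then have xy: "norm (x * y) \<le> K * s * h" using C0 Ksh norm_ge_zero[of "x * y"] by linarith
  \<comment> \<open>The vertical difference is \<open>2 * h\<close> times the partial derivative in
    \<open>y\<close>, up to an error \<open>h ^ 2\<close> from the cube.\<close>
  have "2 * h * norm (x\<^sup>2 + 3 * y\<^sup>2 + of_real (h\<^sup>2)) =
      norm (2 * of_real h * (x\<^sup>2 + 3 * y\<^sup>2 + of_real (h\<^sup>2)))"
    using h by (simp add: norm_mult)
  also have "2 * of_real h * (x\<^sup>2 + 3 * y\<^sup>2 + of_real (h\<^sup>2)) =
      ((x + 0)\<^sup>2 * (y + of_real h) + (y + of_real h) ^ 3)
        - ((x + 0)\<^sup>2 * (y + - of_real h) + (y + - of_real h) ^ 3)"
    by (simp add: power2_eq_square power3_eq_cube algebra_simps)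
  also have "norm \<dots> \<le> C * s ^ 4 + C * s ^ 4"
    by (rule order_trans[OF norm_triangle_ineq4 add_mono]; rule bound) (auto simp: norm_prod_def)
  finally have "2 * h * norm (x\<^sup>2 + 3 * y\<^sup>2 + of_real (h\<^sup>2)) \<le> 2 * h * (\<bar>C\<bar> / c * s * h)"
    using Cs by simp
  then have "norm (x\<^sup>2 + 3 * y\<^sup>2 + of_real (h\<^sup>2)) \<le> \<bar>C\<bar> / c * s * h"
    using h by (simp only: mult_le_cancel_left_pos zero_less_numeral mult_pos_pos)
  moreover have "norm (x\<^sup>2 + 3 * y\<^sup>2) \<le> norm (x\<^sup>2 + 3 * y\<^sup>2 + of_real (h\<^sup>2)) + norm (of_real (h\<^sup>2) :: complex)"
    using norm_triangle_ineq4[of "x\<^sup>2 + 3 * y\<^sup>2 + of_real (h\<^sup>2)" "of_real (h\<^sup>2)"] by simp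
  moreover have "norm (of_real (h\<^sup>2) :: complex) = h\<^sup>2" by (simp only: norm_of_real abs_power2)
  ultimately have q: "norm (x\<^sup>2 + 3 * y\<^sup>2) \<le> K * s * h" using hh Ksh by linarith
  have xs: "norm x \<le> s" "norm y \<le> s" using norm_fst_le[of x y] norm_snd_le[of y x] by (auto simp: s_def z)
  have q2: "norm (v\<^sup>2 * (x\<^sup>2 + 3 * y\<^sup>2)) \<le> s\<^sup>2 * (K * s * h)" if "norm v \<le> s" for v
    unfolding norm_mult norm_power using that q by (intro mult_mono power_mono) auto
  have "norm ((x * y)\<^sup>2) \<le> (K * s * h)\<^sup>2" unfolding norm_power by (rule power_mono[OF xy]) simp
  also have "\<dots> = K\<^sup>2 * s\<^sup>2 * h\<^sup>2" by (simp add: power_mult_distrib)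
  also have "\<dots> \<le> K\<^sup>2 * s\<^sup>2 * (sqrt c * s * h)" using hh by (intro mult_left_mono) auto
  finally have xy2: "3 * norm ((x * y)\<^sup>2) \<le> 3 * K\<^sup>2 * sqrt c * (s ^ 3 * h)"
    by (simp add: power2_eq_square power3_eq_cube mult_ac)
  have K's: "K' * (s ^ 3 * h) = s\<^sup>2 * (K * s * h) + 3 * K\<^sup>2 * sqrt c * (s ^ 3 * h)"
    by (simp add: K'_def power2_eq_square power3_eq_cube algebra_simps)
  \<comment> \<open>The fourth powers of the coordinates lie in the ideal of the partial
    derivatives, so small partials force small coordinates.\<close>
  have "x ^ 4 = x\<^sup>2 * (x\<^sup>2 + 3 * y\<^sup>2) - 3 * (x * y)\<^sup>2" "3 * y ^ 4 = y\<^sup>2 * (x\<^sup>2 + 3 * y\<^sup>2) - (x * y)\<^sup>2"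
    by (simp_all add: power2_eq_square power4_eq_xxxx algebra_simps)
  then have "norm (x ^ 4) \<le> norm (x\<^sup>2 * (x\<^sup>2 + 3 * y\<^sup>2)) + 3 * norm ((x * y)\<^sup>2)"
    "3 * norm (y ^ 4) \<le> norm (y\<^sup>2 * (x\<^sup>2 + 3 * y\<^sup>2)) + norm ((x * y)\<^sup>2)"
    by (metis norm_triangle_ineq4 norm_mult norm_numeral)+
  then have "norm (x ^ 4) \<le> K' * (s ^ 3 * h)" "norm (y ^ 4) \<le> K' * (s ^ 3 * h)"
    using q2[OF xs(1)] q2[OF xs(2)] xy2 K's norm_ge_zero[of "(x * y)\<^sup>2"] norm_ge_zero[of "y ^ 4"]
    by linarith+
  then have "2 ^ 4 * max (norm x ^ 4) (norm y ^ 4) \<le> 2 ^ 4 * (K' * (s ^ 3 * h))"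
    unfolding norm_power by (intro mult_left_mono) auto
  then have "s ^ 4 \<le> 2 ^ 4 * (K' * (s ^ 3 * h))"
    using norm_Pair_power_le[of x y 4] unfolding s_def z by linarith
  \<comment> \<open>It follows that \<open>s\<close> is O(\<open>h\<close>), whereas
    \<open>h ^ 2 = c * s ^ 3\<close>.\<close>
  then have "s ^ 3 * s \<le> s ^ 3 * (16 * K' * h)" by (simp add: power3_eq_cube power4_eq_xxxx mult_ac)
  then have "s \<le> 16 * K' * h" using s by (simp only: mult_le_cancel_left_pos zero_less_power)
  then have "s\<^sup>2 \<le> (16 * K' * h)\<^sup>2" using s by (intro power_mono) auto
  also have "\<dots> = s\<^sup>2 * ((16 * K')\<^sup>2 * c * s)"
    unfolding power_mult_distrib h(2) by (simp add: power2_eq_square power3_eq_cube)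
  finally have "s\<^sup>2 * 1 \<le> s\<^sup>2 * ((16 * K')\<^sup>2 * c * s)" by simp
  then have "1 \<le> (16 * K')\<^sup>2 * c * s" using s by (simp only: mult_le_cancel_left_pos zero_less_power)
  moreover have "((16 * K')\<^sup>2 * c + 1) * s < 1" using s(3) pos by (simp add: field_simps)
  ultimately show False using s by (simp add: distrib_right)
qed

section \<open>Uniqueness of the type and the count\<close>

lemma has_ade_type_cubically_bounded:
  assumes "has_ade_type F p T"
  shows "cubically_bounded (local_equation F p) \<longleftrightarrow> (\<forall>k. T \<noteq> Type_A k)"
proof -
  have comp: "Lipschitz_comparable (local_equation F p) (normal_form T)" and "valid_ade T"
    using assms locally_analytically_equivalent_imp_comparable by (auto simp: has_ade_type_def)
  then show ?thesis
    using cubically_bounded_cong[OF comp] cubically_bounded_cong[OF Lipschitz_comparable_sym[OF comp]]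
      not_cubically_bounded_A cubically_bounded_not_A by blast
qed

lemma has_ade_type_flat_spots:
  assumes "has_ade_type F p T" "M \<ge> 2"
  shows "flat_spots M N (local_equation F p) \<longleftrightarrow> flat_spots M N (normal_form T)"
  using assms flat_spots_cong Lipschitz_comparable_sym locally_analytically_equivalent_imp_comparable
  unfolding has_ade_type_def by blast

text \<open>The cubic bound leaves only type A. For \<open>i < l\<close> the exponent
  \<open>i + 2\<close> is at most \<open>l + 1\<close>, so \<open>Type_A l\<close> has flat spots of
  that order while \<open>Type_A i\<close> has none.\<close>

lemma has_ade_type_A_unique:
  assumes "has_ade_type F p (Type_A j)" "has_ade_type F p T"
  shows "T = Type_A j"
proof -
  obtain k where k: "T = Type_A k"
    using assms has_ade_type_cubically_bounded by metis
  have False if "has_ade_type F p (Type_A i)" "has_ade_type F p (Type_A l)" "i < l" for i l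
  proof -
    have "i \<ge> 1" using that by (simp add: has_ade_type_def)
    then show False
      using has_ade_type_flat_spots[OF that(1), of "i + 2" "i + 2"]
        has_ade_type_flat_spots[OF that(2), of "i + 2" "i + 2"]
        not_flat_spots_A[of i] flat_spots_A[of "i + 2" l] that(3) by simp
  qed
  then show ?thesis using assms k by (metis linorder_neqE_nat)
qed

text \<open>The cubic bound excludes type A, and flat spots of orders 3 and 4 occur for every D or E
  germ except \<open>Type_D 4\<close>.\<close>

lemma has_ade_type_D4_unique:
  assumes "has_ade_type F p (Type_D 4)" "has_ade_type F p T"
  shows "T = Type_D 4"
proof (rule ccontr)
  assume "T \<noteq> Type_D 4"
  moreover have "T \<noteq> Type_A k" for k
    using assms has_ade_type_cubically_bounded by (metis ade_type.distinct(1))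
  moreover have "valid_ade T" using assms by (simp add: has_ade_type_def)
  ultimately have "flat_spots 3 4 (normal_form T)" by (intro flat_spots_degenerate_cubic)
  then show False
    using has_ade_type_flat_spots[OF assms(1), of 3 4] has_ade_type_flat_spots[OF assms(2), of 3 4]
      not_flat_spots_D4 by simp
qed

section \<open>Divisibility by nine in degree ten\<close>

theorem corollary5p8:
  "\<not> (\<exists>F :: form3. MK_curve 10 F \<and>
        (\<forall>p\<in>Sing F. has_ade_type F p (Type_A 1) \<or> has_ade_type F p (Type_A 3) \<or>
                      has_ade_type F p (Type_D 4)))"
proof
  assume "\<exists>F :: form3. MK_curve 10 F \<and>
        (\<forall>p\<in>Sing F. has_ade_type F p (Type_A 1) \<or> has_ade_type F p (Type_A 3) \<or>
                      has_ade_type F p (Type_D 4))"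
  then obtain F where F: "MK_curve 10 F"
    and types: "\<And>p. p \<in> Sing F \<Longrightarrow> has_ade_type F p (Type_A 1) \<or> has_ade_type F p (Type_A 3) \<or>
                      has_ade_type F p (Type_D 4)" by blast
  \<comment> \<open>Uniqueness of the type evaluates the \<open>THE\<close> in
    \<open>mk_number\<close>; the witnesses 4, 10 and 13 are 36, 90 and 117 divided by 9.\<close>
  have "\<exists>n::nat. mk_number F p = 9 / 8 * real n" if p: "p \<in> Sing F" for p
  proof -
    consider "has_ade_type F p (Type_A 1)" | "has_ade_type F p (Type_A 3)" | "has_ade_type F p (Type_D 4)"
      using types[OF p] by blast
    then show ?thesis
    proof cases
      case 1
      then have "(THE T. has_ade_type F p T) = Type_A 1" using has_ade_type_A_unique by blast
      then show ?thesis by (intro exI[of _ 4]) (simp add: mk_number_def ade_mk_number_def)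
    next
      case 2
      then have "(THE T. has_ade_type F p T) = Type_A 3" using has_ade_type_A_unique by blast
      then show ?thesis by (intro exI[of _ 10]) (simp add: mk_number_def ade_mk_number_def)
    next
      case 3
      then have "(THE T. has_ade_type F p T) = Type_D 4" using has_ade_type_D4_unique by blast
      then show ?thesis by (intro exI[of _ 13]) (simp add: mk_number_def ade_mk_number_def)
    qed
  qed
  then obtain n :: "(complex^3) set \<Rightarrow> nat" where n: "\<And>p. p \<in> Sing F \<Longrightarrow> mk_number F p = 9 / 8 * real (n p)"
    by metis
  \<comment> \<open>Were \<open>Sing F\<close> infinite, both sums would take the default value 0
    and the identity would still hold.\<close>
  have "total_mk_number F = (\<Sum>p\<in>Sing F. 9 / 8 * real (n p))"
    unfolding total_mk_number_def by (rule sum.cong[OF refl n])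
  then have "total_mk_number F = 9 / 8 * real (\<Sum>p\<in>Sing F. n p)"
    by (simp only: sum_distrib_left of_nat_sum)
  moreover have "total_mk_number F = 220" using F by (simp add: MK_curve_def)
  ultimately have "real (9 * (\<Sum>p\<in>Sing F. n p)) = real 1760" by simp
  then have "9 * (\<Sum>p\<in>Sing F. n p) = 1760" by (simp only: of_nat_eq_iff)
  \<comment> \<open>1760 leaves the remainder 5 modulo 9.\<close>
  then show False by presburger
qed

end
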